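(* Let $U_1\in\mathbb{R}$, $U_2>0$, $\Delta x>0$, $\Delta t>0$, and set $a=\frac{U_1(\Delta x)^2}{U_2}$ and $\lambda=\frac{(\Delta x)^3}{U_2\,\Delta t}$. For $z\in\mathbb{C}$ with $|z|>1$, put $p=p(z)=2\lambda\,\frac{z-1}{z+1}$ and consider the quartic equation in $\ell$ $$\ell^4-(2-a)\,\ell^3+2p\,\ell^2+(2-a)\,\ell-1=0.$$ Then the continuous roots $\ell_1,\ell_2,\ell_3,\ell_4$ of this equation (in the sense defined in the context) are well separated: for every $\rho>1$, they can be numbered, independently of the angle $\theta$, in such a way that for all $z=\rho e^{i\theta}$, $\theta\in[0,2\pi)$, $$|\ell_1(z)|<1,\qquad |\ell_2(z)|<1,\qquad |\ell_3(z)|>1,\qquad |\ell_4(z)|>1.$$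
   Context: Continuous roots: for $\rho>1$ and $z=\rho e^{i\theta}$ with $\theta\in[0,2\pi)$, the continuous roots are functions $\ell_1,\ell_2,\ell_3,\ell_4$ such that $\theta\mapsto \ell_k(\rho e^{i\theta})$ is continuous on $[0,2\pi)$ for each $k$ and such that, for each $\theta$, the values $\ell_1(z),\dots,\ell_4(z)$ are the four roots, counted with multiplicity, of the equation with parameter $z=\rho e^{i\theta}$. (Such a continuous choice of the roots along the interval always exists.) The assertion holds for any such choice. *)

theory Defs
  imports "HOL-Analysis.Analysis" "HOL-Computational_Algebra.Computational_Algebra"
    "HOL-Combinatorics.Permutations"
begin

definition p_param :: "real \<Rightarrow> complex \<Rightarrow> complex" where
  "p_param lam z = 2 * of_real lam * ((z - 1) / (z + 1))"

definition quartic :: "real \<Rightarrow> real \<Rightarrow> complex \<Rightarrow> complex poly" where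
  "quartic a lam z =
     [:-1, 2 - of_real a, 2 * p_param lam z, - (2 - of_real a), 1:]"

lemma poly_quartic:
  "poly (quartic a lam z) l =
     l ^ 4 - (2 - of_real a) * l ^ 3 + 2 * p_param lam z * l ^ 2 + (2 - of_real a) * l - 1"
  by (simp add: quartic_def algebra_simps power_numeral_reduce)

text \<open>
  The parameter \<open>z\<close> runs over the circle of radius \<open>\<rho>\<close>. Since \<open>\<theta>\<close> ranges over the half-open
  interval \<open>[0, 2 * pi)\<close>, each root is allowed to jump at the positive real axis: following a
  root once around the circle may lead to a different root.
\<close>

definition continuous_roots ::
    "(complex \<Rightarrow> complex poly) \<Rightarrow> real \<Rightarrow> (nat \<Rightarrow> complex \<Rightarrow> complex) \<Rightarrow> bool" where
  "continuous_roots Q \<rho> l \<longleftrightarrow>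
     (\<forall>k\<in>{1..4}. continuous_on {0..<2 * pi} (\<lambda>\<theta>. l k (of_real \<rho> * cis \<theta>))) \<and>
     (\<forall>\<theta>\<in>{0..<2 * pi}. proots (Q (of_real \<rho> * cis \<theta>)) =
        {# l k (of_real \<rho> * cis \<theta>). k \<in># mset_set {1..4} #})"

end

theory Submission
  imports Defs
begin

text \<open>
  For \<open>norm z > 1\<close> the Cayley transform \<open>(z - 1) / (z + 1)\<close> has positive real part. Dividing the
  quartic by \<open>w\<^sup>2\<close> at a point \<open>w\<close> of the unit circle and taking real parts leaves only
  \<open>2 Re p\<close>, so no root ever lies on the unit circle, and by connectedness each continuous root stays
  on one side of it. It remains to count at \<open>\<theta> = 0\<close>, where the quartic is real, equal to \<open>2 p > 0\<close>
  at \<open>1\<close> and \<open>-1\<close>, and equal to \<open>-1\<close> at \<open>0\<close>: it has a root in \<open>(0, 1)\<close> and one in \<open>(-1, 0)\<close>, and the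
  remaining quadratic factor is positive at \<open>1\<close> and \<open>-1\<close> with constant term greater than \<open>1\<close>,
  which forces both of its roots outside the closed unit disc.
\<close>

text \<open>The real part equals \<open>((norm z)^2 - 1) / (norm (z + 1))^2\<close>.\<close>

lemma Re_cayley_pos:
  fixes z :: complex
  assumes "norm z > 1"
  shows "Re ((z - 1) / (z + 1)) > 0"
proof -
  have sq: "(Re z)\<^sup>2 + (Im z)\<^sup>2 > 1"
    using assms by (metis cmod_power2 one_less_power pos2)
  have "z \<noteq> -1"
    using assms by auto
  hence "norm (z + 1) > 0"
    by (simp add: add_eq_0_iff2)
  hence "(Re z + 1)\<^sup>2 + (Im z)\<^sup>2 > 0"
    using cmod_power2[of "z + 1"] by (metis Im_complex_of_real Re_complex_of_real add.right_neutral
        of_real_1 plus_complex.sel zero_less_power)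
  thus ?thesis
    using sq by (simp add: Re_divide power2_eq_square algebra_simps divide_pos_pos)
qed

lemma p_param_Re_pos:
  assumes "lam > 0" "norm z > 1"
  shows "Re (p_param lam z) > 0"
proof -
  have "Re (p_param lam z) = 2 * lam * Re ((z - 1) / (z + 1))"
    by (simp only: p_param_def mult_2 distrib_right plus_complex.sel Re_complex_of_real
        Im_complex_of_real times_complex.sel)
  thus ?thesis
    using assms Re_cayley_pos by simp
qed

lemma quartic_no_unit_root:
  assumes p: "Re (p_param lam z) > 0" and root: "poly (quartic a lam z) w = 0"
  shows "norm w \<noteq> 1"
proof
  assume "norm w = 1"
  hence w: "w * cnj w = 1"
    by (simp add: complex_norm_square[symmetric])
  define c where "c = cnj w"
  have wc: "w * c = 1"
    using w by (simp add: c_def)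
  have "0 = (w ^ 4 - (2 - of_real a) * w ^ 3 + 2 * p_param lam z * w ^ 2
             + (2 - of_real a) * w - 1) * c ^ 2"
    using root by (simp add: poly_quartic)
  \<comment> \<open>On the unit circle \<open>c\<close> is the inverse of \<open>w\<close>. Since it
    is also the conjugate, \<open>w ^ 2 - c ^ 2\<close> and \<open>w - c\<close> are purely
    imaginary, and \<open>a\<close> is real, so only the term in \<open>p_param\<close> has a
    nonzero real part.\<close>
  also have "\<dots> = w ^ 2 - c ^ 2 - (2 - of_real a) * (w - c) + 2 * p_param lam z"
    using wc by algebra
  finally have "Re (w ^ 2 - c ^ 2 - (2 - of_real a) * (w - c) + 2 * p_param lam z) = 0"
    by simp
  thus False
    using p by (simp add: c_def power2_eq_square)
qed

lemma real_quartic_two_roots: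
  fixes b p :: real
  assumes "p > 0"
  obtains r s where "0 < r" "r < 1" "-1 < s" "s < 0"
    "r ^ 4 - b * r ^ 3 + 2 * p * r ^ 2 + b * r - 1 = 0"
    "s ^ 4 - b * s ^ 3 + 2 * p * s ^ 2 + b * s - 1 = 0"
proof -
  define f where "f x = x ^ 4 - b * x ^ 3 + 2 * p * x ^ 2 + b * x - 1" for x
  have cont: "continuous_on A f" for A
    unfolding f_def by (intro continuous_intros)
  have v: "f 0 = -1" "f 1 = 2 * p" "f (-1) = 2 * p"
    by (simp_all add: f_def)
  obtain r where r: "0 \<le> r" "r \<le> 1" "f r = 0"
    using IVT'[of f 0 0 1] cont v assms by auto
  obtain s where s: "-1 \<le> s" "s \<le> 0" "f s = 0"
    using IVT2'[of f 0 0 "-1"] cont v assms by auto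
  have "r \<noteq> 0" "r \<noteq> 1" "s \<noteq> 0" "s \<noteq> -1"
    using r s v assms by auto
  with r s show ?thesis
    by (intro that[of r s]) (auto simp: f_def)
qed

text \<open>Both \<open>u\<close> and \<open>v\<close> are roots of the real polynomial
  \<open>X^2 - s X + t\<close>, and the bound on \<open>s\<close> says that it is positive at 1 and
  -1. A non-real root has squared modulus \<open>t > 1\<close>; a real root in
  \<open>[-1, 1]\<close> is ruled out by an estimate.\<close>

lemma quadratic_root_outside_disc:
  fixes u v :: complex and s t :: real
  assumes prod: "u * v = of_real t" and sum: "u + v = of_real s"
    and t: "t > 1" and s: "\<bar>s\<bar> < 1 + t"
  shows "norm u > 1"
proof (rule ccontr)
  assume "\<not> norm u > 1"
  hence le: "norm u \<le> 1"
    by simp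
  define x y where "x = Re u" and "y = Im u"
  have u: "u = Complex x y"
    by (simp add: x_def y_def)
  have "u * u + of_real t = of_real s * u"
    unfolding prod[symmetric] sum[symmetric] by (simp add: algebra_simps)
  hence re: "x * x - y * y + t = s * x" and im: "2 * x * y = s * y"
    by (auto simp: u complex_eq_iff)
  show False
  proof (cases "y = 0")
    case False
    hence "s = 2 * x"
      using im by simp
    hence "t = (norm u)\<^sup>2"
      unfolding cmod_power2 using re by (simp add: u power2_eq_square)
    also have "\<dots> \<le> 1"
      using le by (simp add: power_le_one)
    finally show False
      using t by simp
  next
    case True
    have x1: "\<bar>x\<bar> \<le> 1"
      using le abs_Re_le_cmod[of u] by (simp add: x_def)
    have "x \<noteq> 0"
      using re t True by auto
    hence "\<bar>s\<bar> * \<bar>x\<bar> < (1 + t) * \<bar>x\<bar>"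
      using s by simp
    moreover have "s * x \<le> \<bar>s\<bar> * \<bar>x\<bar>"
      by (metis abs_ge_self abs_mult)
    \<comment> \<open>This product is \<open>x^2 - (1 + t) \<bar>x\<bar> + t\<close>, a strict lower
      bound for \<open>x^2 - s x + t\<close>, which \<open>re\<close> makes zero.\<close>
    moreover have "(1 - \<bar>x\<bar>) * (t - \<bar>x\<bar>) \<ge> 0"
      using x1 t by simp
    moreover have "\<bar>x\<bar> * \<bar>x\<bar> = x * x"
      by simp
    ultimately show False
      using re True by (simp add: algebra_simps)
  qed
qed

text \<open>Evaluating the factorization at 0, 1 and -1 shows that \<open>u * v\<close>,
  \<open>(1 - u) * (1 - v)\<close> and \<open>(1 + u) * (1 + v)\<close> are the real numbers
  \<open>t\<close>, \<open>A\<close>, \<open>B\<close>. Then \<open>A + B = 2 * (1 + t)\<close> and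
  \<open>B - A = 2 * (u + v)\<close>, so positivity of \<open>A\<close> and \<open>B\<close> is the
  bound required by \<open>quadratic_root_outside_disc\<close>.\<close>

lemma real_quartic_other_roots_outside:
  fixes r s b p :: real and u v :: complex
  assumes p: "p > 0" and r: "0 < r" "r < 1" and s: "-1 < s" "s < 0"
    and fact: "\<And>x :: complex. x ^ 4 - of_real b * x ^ 3 + 2 * of_real p * x ^ 2 + of_real b * x - 1
      = (x - of_real r) * (x - of_real s) * (x - u) * (x - v)"
  shows "norm u > 1"
proof -
  define t A B where "t = -1 / (r * s)"
    and "A = 2 * p / ((1 - r) * (1 - s))" and "B = 2 * p / ((1 + r) * (1 + s))"
  have quot: "w = of_real (d / c)" if "of_real c * w = of_real d" "c \<noteq> 0" for w :: complex and c d
    using that by (simp add: nonzero_eq_divide_eq mult.commute)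
  have "of_real (r * s) * (u * v) = of_real (-1)"
    using fact[of 0] by (simp add: algebra_simps)
  hence uv: "u * v = of_real t"
    unfolding t_def using r s by (intro quot) auto
  have "of_real ((1 - r) * (1 - s)) * ((1 - u) * (1 - v)) = of_real (2 * p)"
    using fact[of 1] by (simp add: algebra_simps)
  hence A: "(1 - u) * (1 - v) = of_real A"
    unfolding A_def using r s by (intro quot) auto
  have "of_real ((1 + r) * (1 + s)) * ((1 + u) * (1 + v)) = of_real (2 * p)"
    using fact[of "-1"] by (simp add: algebra_simps)
  hence B: "(1 + u) * (1 + v) = of_real B"
    unfolding B_def using r s by (intro quot) auto
  have pos: "A > 0" "B > 0"
    using p r s by (simp_all add: A_def B_def)
  have "2 * (1 + of_real t) = (of_real (A + B) :: complex)"
    using A B uv by (simp add: algebra_simps flip: A B)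
  hence "of_real (2 * (1 + t)) = (of_real (A + B) :: complex)"
    by simp
  hence AB: "2 * (1 + t) = A + B"
    using of_real_eq_iff by blast
  have "2 * (u + v) = of_real (B - A)"
    by (simp add: algebra_simps flip: A B)
  hence sum: "u + v = of_real ((B - A) / 2)"
    by (intro quot) simp_all
  \<comment> \<open>The product of all four roots is -1, so \<open>\<bar>r * s\<bar> < 1\<close>
    forces \<open>t > 1\<close>.\<close>
  have "r * (- s) < 1 * 1"
    using r s by (intro mult_strict_mono) auto
  hence "t > 1"
    using r s by (simp add: t_def field_simps mult_pos_neg)
  moreover have "\<bar>(B - A) / 2\<bar> < 1 + t"
  proof -
    have "1 + t = (A + B) / 2"
      using AB by simp
    thus ?thesis
      using pos by (simp add: abs_less_iff field_simps)
  qed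
  ultimately show ?thesis
    using quadratic_root_outside_disc uv sum by blast
qed

lemma quartic_roots_split_real:
  fixes r :: "nat \<Rightarrow> complex"
  assumes lam: "lam > 0" and \<rho>: "\<rho> > 1"
    and roots: "proots (quartic a lam (of_real \<rho>)) = {# r k. k \<in># mset_set {1..4} #}"
  obtains \<sigma> where "\<sigma> permutes {1..4}"
    "norm (r (\<sigma> 1)) < 1" "norm (r (\<sigma> 2)) < 1" "norm (r (\<sigma> 3)) > 1" "norm (r (\<sigma> 4)) > 1"
proof -
  define p b where "p = 2 * lam * ((\<rho> - 1) / (\<rho> + 1))" and "b = 2 - a"
  let ?Q = "quartic a lam (of_real \<rho>)"
  have p: "p > 0"
    using lam \<rho> by (simp add: p_def)
  have pp: "p_param lam (of_real \<rho>) = of_real p"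
    by (simp add: p_param_def p_def)
  have Q: "poly ?Q x = x ^ 4 - of_real b * x ^ 3 + 2 * of_real p * x ^ 2 + of_real b * x - 1" for x
    by (simp add: poly_quartic pp b_def)
  \<comment> \<open>Factoring over the indices 1 to 4 rather than over root values keeps track of
    multiplicities.\<close>
  have "lead_coeff ?Q = 1"
    by (simp add: quartic_def)
  hence "?Q = (\<Prod>x\<in>#proots ?Q. [:-x, 1:])"
    using complex_poly_decompose_multiset[of ?Q] by simp
  also have "\<dots> = (\<Prod>k\<in>{1..4}. [:- r k, 1:])"
    by (simp only: roots image_mset.compositionality comp_def prod_unfold_prod_mset)
  finally have "poly ?Q x = poly (\<Prod>k\<in>{1..4}. [:- r k, 1:]) x" for x
    by simp
  hence fact: "poly ?Q x = (\<Prod>k\<in>{1..4}. x - r k)" for x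
    by (simp add: poly_prod)
  obtain r1 r2 where r1: "0 < r1" "r1 < 1" and r2: "-1 < r2" "r2 < 0"
    and f: "r1 ^ 4 - b * r1 ^ 3 + 2 * p * r1 ^ 2 + b * r1 - 1 = 0"
      "r2 ^ 4 - b * r2 ^ 3 + 2 * p * r2 ^ 2 + b * r2 - 1 = 0"
    using real_quartic_two_roots[OF p] by metis
  have "poly ?Q (of_real x) = of_real (x ^ 4 - b * x ^ 3 + 2 * p * x ^ 2 + b * x - 1)" for x
    by (simp add: Q)
  hence "poly ?Q (of_real r1) = 0" "poly ?Q (of_real r2) = 0"
    using f by (simp_all only: of_real_0)
  then obtain i j where i: "i \<in> {1..4}" "r i = of_real r1" and j: "j \<in> {1..4}" "r j = of_real r2"
    by (auto simp: fact)
  \<comment> \<open>The two real roots have opposite signs.\<close>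
  have ij: "i \<noteq> j"
    using i j r1 r2 by auto
  have "card ({1..4} - {i, j}) = 2"
    using i j ij by (subst card_Diff_subset) auto
  then obtain m n where mn: "{1..4} - {i, j} = {m, n}" "m \<noteq> n"
    by (auto simp: card_2_iff)
  have all: "{1..4} = {i, j, m, n}"
    using mn i j by blast
  have dist: "m \<noteq> i" "m \<noteq> j" "n \<noteq> i" "n \<noteq> j"
    using mn by blast+
  have fact4: "x ^ 4 - of_real b * x ^ 3 + 2 * of_real p * x ^ 2 + of_real b * x - 1
      = (x - of_real r1) * (x - of_real r2) * (x - r m) * (x - r n)" for x
    using dist ij mn(2) i(2) j(2) unfolding Q[symmetric] fact all by (simp add: mult.assoc)
  have m: "norm (r m) > 1"
    by (rule real_quartic_other_roots_outside[OF p r1 r2 fact4])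
  \<comment> \<open>The lemma bounds the root in the position of \<open>u\<close>, so the last two
    factors are swapped.\<close>
  have n: "norm (r n) > 1"
    by (rule real_quartic_other_roots_outside[OF p r1 r2, of b "r n" "r m"])
      (subst fact4, simp only: mult_ac)
  define \<sigma> where
    "\<sigma> k = (if k = 1 then i else if k = 2 then j else if k = 3 then m else if k = 4 then n else k)"
    for k :: nat
  have four: "{1..4} = {1, 2, 3, 4 :: nat}"
    by auto
  have "\<sigma> permutes {1..4}"
  proof (rule bij_imp_permutes)
    have "\<sigma> ` {1..4} = {i, j, m, n}"
      unfolding four by (auto simp: \<sigma>_def)
    also note all [symmetric]
    finally show "bij_betw \<sigma> {1..4} {1..4}"
      by (simp add: bij_betw_def eq_card_imp_inj_on)
  qed (auto simp: \<sigma>_def)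
  moreover have "norm (r (\<sigma> 1)) < 1" "norm (r (\<sigma> 2)) < 1"
    using i j r1 r2 by (simp_all add: \<sigma>_def)
  moreover have "norm (r (\<sigma> 3)) > 1" "norm (r (\<sigma> 4)) > 1"
    using m n by (simp_all add: \<sigma>_def)
  ultimately show ?thesis
    using that by blast
qed

text \<open>A connected image containing values on both sides of \<open>c\<close> would contain
  \<open>c\<close> itself.\<close>

lemma connected_avoid_sign:
  fixes f :: "'a::topological_space \<Rightarrow> 'b::linorder_topology"
  assumes "connected S" "continuous_on S f" "\<And>x. x \<in> S \<Longrightarrow> f x \<noteq> c" "x \<in> S" "y \<in> S"
  shows "f x < c \<longleftrightarrow> f y < c"
proof -
  have "connected (f ` S)"
    using assms by (intro connected_continuous_image)
  thus ?thesis
    using assms connectedD_interval[of "f ` S" "f x" "f y" c]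
      connectedD_interval[of "f ` S" "f y" "f x" c]
    by (metis (no_types, lifting) imageE imageI linorder_not_le order_less_imp_le)
qed

theorem theorem3p2:
  fixes U1 U2 dx dt a lam \<rho> :: real
    and l :: "nat \<Rightarrow> complex \<Rightarrow> complex"
  assumes "U2 > 0" and "dx > 0" and "dt > 0"
    and "a = U1 * dx ^ 2 / U2"
    and "lam = dx ^ 3 / (U2 * dt)"
    and "\<rho> > 1"
    and "continuous_roots (quartic a lam) \<rho> l"
  shows "\<exists>\<sigma>. \<sigma> permutes {1..4} \<and>
    (\<forall>\<theta>\<in>{0..<2 * pi}. let z = of_real \<rho> * cis \<theta> in
       norm (l (\<sigma> 1) z) < 1 \<and> norm (l (\<sigma> 2) z) < 1 \<and>
       norm (l (\<sigma> 3) z) > 1 \<and> norm (l (\<sigma> 4) z) > 1)"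
proof -
  let ?z = "\<lambda>\<theta>. of_real \<rho> * cis \<theta>"
  let ?I = "{0..<2 * pi}"
  have lam: "lam > 0"
    using assms by simp
  have cont: "continuous_on ?I (\<lambda>\<theta>. l k (?z \<theta>))" if "k \<in> {1..4}" for k
    using assms(7) that by (auto simp: continuous_roots_def)
  have roots: "proots (quartic a lam (?z \<theta>)) = {# l k (?z \<theta>). k \<in># mset_set {1..4} #}"
    if "\<theta> \<in> ?I" for \<theta>
    using assms(7) that by (auto simp: continuous_roots_def)
  have ne: "norm (l k (?z \<theta>)) \<noteq> 1" if k: "k \<in> {1..4}" and \<theta>: "\<theta> \<in> ?I" for k \<theta>
  proof (rule quartic_no_unit_root)
    show "Re (p_param lam (?z \<theta>)) > 0"
      using lam assms(6) by (intro p_param_Re_pos) (simp_all add: norm_mult)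
    have "quartic a lam (?z \<theta>) \<noteq> 0"
      by (simp add: quartic_def)
    moreover have "l k (?z \<theta>) \<in># proots (quartic a lam (?z \<theta>))"
      using k by (auto simp: roots[OF \<theta>])
    ultimately show "poly (quartic a lam (?z \<theta>)) (l k (?z \<theta>)) = 0"
      by simp
  qed
  have zero: "0 \<in> ?I"
    by simp
  \<comment> \<open>The half-open interval \<open>?I\<close> is connected, so the value at angle 0
    decides the side for every \<theta>, even if the roots are permuted after a full turn.\<close>
  have side: "norm (l k (?z \<theta>)) < 1 \<longleftrightarrow> norm (l k (?z 0)) < 1"
    if "k \<in> {1..4}" "\<theta> \<in> ?I" for k \<theta>
    by (rule connected_avoid_sign[where S = ?I and f = "\<lambda>\<theta>. norm (l k (?z \<theta>))"])
      (use that zero in \<open>simp_all add: continuous_on_norm cont ne del: atLeastLessThan_iff\<close>)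
  obtain \<sigma> where \<sigma>: "\<sigma> permutes {1..4}"
    "norm (l (\<sigma> 1) (?z 0)) < 1" "norm (l (\<sigma> 2) (?z 0)) < 1"
    "norm (l (\<sigma> 3) (?z 0)) > 1" "norm (l (\<sigma> 4) (?z 0)) > 1"
    using quartic_roots_split_real[OF lam assms(6), of a "\<lambda>k. l k (?z 0)"] roots[OF zero] by auto
  have in4: "\<sigma> k \<in> {1..4}" if "k \<in> {1..4}" for k
    using \<sigma>(1) that by (simp only: permutes_in_image)
  have inside: "norm (l (\<sigma> k) (?z \<theta>)) < 1"
    if "norm (l (\<sigma> k) (?z 0)) < 1" "k \<in> {1..4}" "\<theta> \<in> ?I" for k \<theta>
    using side[OF in4] that by blast
  have outside: "norm (l (\<sigma> k) (?z \<theta>)) > 1"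
    if "norm (l (\<sigma> k) (?z 0)) > 1" "k \<in> {1..4}" "\<theta> \<in> ?I" for k \<theta>
    \<comment> \<open>Here \<open>side\<close> gives only a modulus of at least 1; \<open>ne\<close>
      makes the inequality strict.\<close>
    using side[OF in4, of k \<theta>] ne[OF in4, of k \<theta>] that by linarith
  show ?thesis
    unfolding Let_def using \<sigma> inside outside
    by (intro exI[of _ \<sigma>] conjI ballI) auto
qed

end
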